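(* Let $n \ge k \ge 3$ be integers and let $m = \lceil (n-k)/2 \rceil$. Then \[ \mathrm{La}_{\mathrm{c}}(n, Y_k, Y'_k) = 2^{n} - S(n,k,m). \]
   Context: For integers $k\ge 2$ and $r$, $S(n,k,r) = \sum_{0\le i\le n,\ i \equiv r \pmod k}\binom{n}{i}$. For $k\ge 2$, a family $\mathcal{F}$ of subsets of $[n]=\{1,\dots,n\}$ contains a copy of $Y_k$ on consecutive levels if it contains $k+1$ distinct sets $F_1, F_2, G_1, \ldots, G_{k-1}$ with $G_1\subset G_2 \subset \cdots \subset G_{k-1} \subset F_1$, $G_{k-1}\subset F_2$, and $|F_1| = |F_2| = |G_{k-1}|+1 = |G_{k-2}|+2 = \cdots = |G_1|+k-1$. It contains a copy of $Y'_k$ on consecutive levels if it contains $k+1$ distinct sets $F_1,F_2,G_1,\ldots,G_{k-1}$ with $G_1\supset G_2\supset\cdots\supset G_{k-1}\supset F_1$, $G_{k-1}\supset F_2$, and $|F_1|=|F_2|=|G_{k-1}|-1=\cdots=|G_1|-(k-1)$. $\mathrm{La}_{\mathrm{c}}(n, Y_k, Y'_k)$ denotes the maximum size of a family of subsets of $[n]$ containing neither a copy of $Y_k$ nor a copy of $Y'_k$ on consecutive levels. *)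

theory Defs
  imports Complex_Main "HOL-Number_Theory.Cong"
begin

definition S :: "nat \<Rightarrow> nat \<Rightarrow> int \<Rightarrow> nat" where
  "S n k r = (\<Sum>i | i \<le> n \<and> [int i = r] (mod int k). n choose i)"

text \<open>The chain \<open>G\<^sub>1, \<dots>, G\<^sub>k\<^sub>-\<^sub>1\<close> is a function whose values matter only at the indices
  \<open>1, \<dots>, k - 1\<close>. For such an index \<open>i\<close>, the sets \<open>F\<^sub>1\<close>, \<open>F\<^sub>2\<close> lie
  \<open>k - i\<close> levels above (respectively below) \<open>G\<^sub>i\<close>.\<close>

definition contains_Y :: "nat \<Rightarrow> nat set set \<Rightarrow> bool" where
  "contains_Y k \<F> \<longleftrightarrow>
     (\<exists>F1 F2 (G :: nat \<Rightarrow> nat set).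
        F1 \<in> \<F> \<and> F2 \<in> \<F> \<and> (\<forall>i\<in>{1..<k}. G i \<in> \<F>) \<and>
        distinct (F1 # F2 # map G [1..<k]) \<and>
        (\<forall>i. 1 \<le> i \<and> i + 1 < k \<longrightarrow> G i \<subset> G (i + 1)) \<and>
        G (k - 1) \<subset> F1 \<and> G (k - 1) \<subset> F2 \<and>
        card F1 = card F2 \<and> (\<forall>i\<in>{1..<k}. card F1 = card (G i) + (k - i)))"

definition contains_Y' :: "nat \<Rightarrow> nat set set \<Rightarrow> bool" where
  "contains_Y' k \<F> \<longleftrightarrow>
     (\<exists>F1 F2 (G :: nat \<Rightarrow> nat set).
        F1 \<in> \<F> \<and> F2 \<in> \<F> \<and> (\<forall>i\<in>{1..<k}. G i \<in> \<F>) \<and>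
        distinct (F1 # F2 # map G [1..<k]) \<and>
        (\<forall>i. 1 \<le> i \<and> i + 1 < k \<longrightarrow> G (i + 1) \<subset> G i) \<and>
        F1 \<subset> G (k - 1) \<and> F2 \<subset> G (k - 1) \<and>
        card F1 = card F2 \<and> (\<forall>i\<in>{1..<k}. card (G i) = card F1 + (k - i)))"

text \<open>The maximum ranges over a finite set, which is nonempty because the empty family
  contains neither configuration.\<close>

definition La_c :: "nat \<Rightarrow> nat \<Rightarrow> nat" where
  "La_c n k = Max {card \<F> | \<F>. \<F> \<subseteq> Pow {1..n} \<and> \<not> contains_Y k \<F> \<and> \<not> contains_Y' k \<F>}"

end

theory Submission
  imports Defs "HOL-Combinatorics.Permutations"
begin

text \<open>Upper bound. A uniformly random permutation \<open>\<pi>\<close> of \<open>[n]\<close> gives the maximal chain of the sets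
  \<open>\<pi> ` {1..i}\<close>; let \<open>\<mu>\<^sub>i\<close> be the probability that its member of size \<open>i\<close> is missing from \<open>\<F>\<close>. Fix
  \<open>k\<close> consecutive levels \<open>s, \<dots>, s + k - 1\<close> and exchange independently the lowest set of the chain
  in this window (\<open>a = s + 1\<close> choices) and the highest one (\<open>d = n - s - k + 2\<close> choices); \<open>k \<ge> 3\<close>
  keeps the two apart. If the rest of the window lies in \<open>\<F>\<close>, a low set in \<open>\<F>\<close> allows at most
  one high set in \<open>\<F>\<close> (no \<open>Y\<^sub>k\<close>), and vice versa (no \<open>Y'\<^sub>k\<close>). So the sum of the \<open>\<mu>\<^sub>i\<close> over the
  window is at least \<open>min 1 ((a - 1) / a + (d - 1) / d)\<close>, which is \<open>1\<close> except for the lowest and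
  the highest window.

  If every window had sum at least \<open>1\<close>, rounding would give an integral set of levels that
  meets every window and whose weight (in binomial coefficients) is at most the number of
  missing sets, and such a set weighs at least \<open>S n k m\<close>. The two deficient windows are
  repaired by adding weight on the levels \<open>0\<close> and \<open>n\<close>, at a total cost of at most
  \<open>2 / (n - k + 2)\<close>; this is less than \<open>1\<close> for \<open>n > k\<close>, so integrality absorbs it. The case
  \<open>n = k\<close> is settled directly.\<close>

section \<open>Sums of binomial coefficients over a residue class\<close>

lemma S_eq_sum_if:
  "S n k r = (\<Sum>i\<le>n. if [int i = r] (mod int k) then n choose i else 0)"
  unfolding S_def by (subst sum.inter_filter[symmetric]) (auto intro: sum.cong)

text \<open>Pascal's rule, summed over the residue class.\<close>

lemma S_Suc: "S (Suc n) k r = S n k r + S n k (r - 1)"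
proof -
  have shift: "[int (Suc i) = r] (mod int k) \<longleftrightarrow> [int i = r - 1] (mod int k)" for i
    by (simp add: cong_iff_dvd_diff algebra_simps)
  let ?f = "\<lambda>i. if [int i = r] (mod int k) then n choose i else 0"
  have "S (Suc n) k r = ?f 0 + (\<Sum>i\<le>n. ?f (Suc i) +
      (if [int i = r - 1] (mod int k) then n choose i else 0))"
    unfolding S_eq_sum_if sum.atMost_Suc_shift shift
    by (auto intro!: sum.cong arg_cong2[where f = "(+)"])
  also have "\<dots> = (\<Sum>i\<le>Suc n. ?f i) + S n k (r - 1)"
    unfolding sum.distrib sum.atMost_Suc_shift S_eq_sum_if by simp
  also have "(\<Sum>i\<le>Suc n. ?f i) = S n k r"
    unfolding S_eq_sum_if by simp
  finally show ?thesis .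
qed

lemma S_cong: "[r = r'] (mod int k) \<Longrightarrow> S n k r = S n k r'"
  unfolding S_eq_sum_if by (metis (no_types, lifting) cong_sym cong_trans)

text \<open>The substitution of \<open>n - i\<close> for \<open>i\<close> preserves binomial
  coefficients and reflects the residue class.\<close>

lemma S_reflect: "S n k (int n - r) = S n k r"
proof -
  have "S n k r = (\<Sum>i\<le>n. if [int (n - i) = r] (mod int k) then n choose (n - i) else 0)"
    unfolding S_eq_sum_if
    by (rule sum.reindex_bij_witness[of _ "\<lambda>i. n - i" "\<lambda>i. n - i"]) auto
  also have "\<dots> = S n k (int n - r)"
    unfolding S_eq_sum_if
  proof (intro sum.cong refl)
    fix i assume i: "i \<in> {..n}"
    then have "[int (n - i) = r] (mod int k) \<longleftrightarrow> [int i = int n - r] (mod int k)"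
      by (simp add: cong_iff_dvd_diff of_nat_diff)
        (metis dvd_minus_iff minus_diff_eq add.commute diff_diff_add)
    then show "(if [int (n - i) = r] (mod int k) then n choose (n - i) else 0) =
      (if [int i = int n - r] (mod int k) then n choose i else 0)"
      using i by (simp add: binomial_symmetric[symmetric])
  qed
  finally show ?thesis ..
qed

text \<open>On residues modulo \<open>k\<close>, \<open>S n k\<close> is unimodal with peak at \<open>n / 2\<close>.\<close>
lemma S_antimono:
  assumes "k > 0" "\<bar>2 * a - int n\<bar> \<le> \<bar>2 * b - int n\<bar>" "\<bar>2 * b - int n\<bar> \<le> int k"
  shows "S n k b \<le> S n k a"
  using assms(2,3)
proof (induction n arbitrary: a b)
  case 0
  show ?case
  proof (cases "[0 = b] (mod int k)")
    case True
    have "int k dvd b"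
      using True by (simp add: cong_iff_dvd_diff)
    moreover have "\<bar>b\<bar> < int k"
      using 0 \<open>k > 0\<close> by linarith
    ultimately have "b = 0"
      using dvd_imp_le_int by force
    then show ?thesis
      using 0 by simp
  next
    case False
    then show ?thesis
      by (simp add: S_eq_sum_if)
  qed
next
  case (Suc n)
  \<comment> \<open>Reflection replaces \<open>b\<close> and \<open>a\<close> by representatives
    \<open>x\<close> and \<open>y\<close> above the centre. After Pascal's rule the term at
    \<open>x - 1\<close> is compared with the one at \<open>y\<close>, and the term at
    \<open>x\<close> with the one at \<open>y - 1\<close>.\<close>
  define x where "x = max b (int (Suc n) - b)"
  define y where "y = max a (int (Suc n) - a)"
  have x: "S (Suc n) k b = S n k x + S n k (x - 1)"
    using S_reflect[of "Suc n" k b] S_Suc[of n k x] by (auto simp: x_def max_def)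
  have y: "S (Suc n) k a = S n k y + S n k (y - 1)"
    using S_reflect[of "Suc n" k a] S_Suc[of n k y] by (auto simp: y_def max_def)
  have ge: "2 * x \<ge> int n + 1" "2 * y \<ge> int n + 1" and "y \<le> x" and le: "2 * x \<le> int n + 1 + int k"
    using Suc.prems by (auto simp: x_def y_def max_def abs_if split: if_splits)
  show ?case
  proof (cases "x = y")
    case True
    then show ?thesis
      using x y by simp
  next
    case False
    then have "y \<le> x - 1"
      using \<open>y \<le> x\<close> by simp
    then have "S n k (x - 1) \<le> S n k y"
      by (intro Suc.IH) (use ge le in auto)
    moreover have "S n k x \<le> S n k (y - 1)"
    \<comment> \<open>At equality \<open>x\<close> is too far from \<open>n / 2\<close> for the
      induction hypothesis, but \<open>n - x\<close> and \<open>x - 1\<close> are congruent modulo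
      \<open>k\<close>, so \<open>x - 1\<close> can replace \<open>x\<close>.\<close>
    proof (cases "2 * x = int n + 1 + int k")
      case True
      then have "S n k x = S n k (x - 1)"
        using S_reflect[of n k x] by (metis (no_types) S_cong add_diff_cancel_left' cong_iff_dvd_diff
          diff_add_eq dvd_refl mult_2 diff_diff_add diff_diff_eq2 add.commute)
      moreover have "S n k (x - 1) \<le> S n k (y - 1)"
        by (intro Suc.IH) (use ge le \<open>y \<le> x - 1\<close> True in auto)
      ultimately show ?thesis by simp
    next
      case False
      then show ?thesis
        by (intro Suc.IH) (use ge le \<open>y \<le> x - 1\<close> in auto)
    qed
    ultimately show ?thesis
      using x y by simp
  qed
qed

section \<open>Sets of levels that meet every window\<close>

text \<open>\<open>t\<close> lies between \<open>i\<close> and its mirror image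
  \<open>n - i\<close>, hence is no farther from \<open>n / 2\<close> than \<open>i\<close>.\<close>

lemma binomial_le_between:
  assumes "i \<le> t" "i + t \<le> n"
  shows "n choose i \<le> n choose t"
proof (cases "2 * t \<le> n")
  case True
  then show ?thesis
    using assms by (intro binomial_mono)
next
  case False
  have "n choose i \<le> n choose (n - t)"
    using assms False by (intro binomial_mono) auto
  also have "\<dots> = n choose t"
    using assms by (intro binomial_symmetric[symmetric]) auto
  finally show ?thesis .
qed

text \<open>Starting from one element \<open>a\<close> of \<open>T\<close> near \<open>n / 2\<close>, every level \<open>i \<equiv> a\<close> is assigned an
  element of \<open>T\<close> in the window of length \<open>k\<close> that begins at \<open>i\<close> and points towards \<open>a\<close>. These
  windows are disjoint and binomial coefficients do not decrease on them.\<close>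
lemma hitting_set_weight_ge:
  assumes "1 \<le> k" "T \<subseteq> {..n}"
    and hits: "\<And>s. s + k \<le> Suc n \<Longrightarrow> \<exists>t\<in>T. s \<le> t \<and> t < s + k"
    and a: "a \<in> T" "n \<le> 2 * a + k + 1" "2 * a \<le> n + k + 1"
  shows "S n k (int a) \<le> (\<Sum>i\<in>T. n choose i)"
proof -
  define R where "R = {i. i \<le> n \<and> [int i = int a] (mod int k)}"
  define good where "good i t \<longleftrightarrow> t \<in> T \<and> n choose i \<le> n choose t \<and>
    (if i < a then i \<le> t \<and> t < i + k else if a < i then t \<le> i \<and> i < t + k else t = a)" for i t
  have sep: "i + k \<le> j" if "i < j" "[int i = int j] (mod int k)" for i j
  proof -
    have "int k dvd int j - int i"
      using that(2) by (simp add: cong_iff_dvd_diff dvd_diff_commute)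
    then show ?thesis
      using zdvd_imp_le[of "int k" "int j - int i"] that(1) by simp
  qed
  have "\<exists>t. good i t" if "i \<in> R" for i
  proof (cases i a rule: linorder_cases)
    case less
    then have "i + k \<le> a"
      using that sep[of i a] by (simp add: R_def)
    moreover from this obtain t where "t \<in> T" "i \<le> t" "t < i + k"
      using hits[of i] a assms(2) by auto
    ultimately show ?thesis
      unfolding good_def using less a by (intro exI[of _ t]) (auto intro: binomial_le_between)
  next
    case equal
    then show ?thesis
      using a by (auto simp: good_def)
  next
    case greater
    then have "a + k \<le> i" and "i \<le> n"
      using that sep[of a i] by (simp_all add: R_def cong_sym_eq)
    moreover from this obtain t where t: "t \<in> T" "i < t + k" "t \<le> i"
      using hits[of "Suc i - k"] by force
    \<comment> \<open>From \<open>i \<ge> a + k\<close> and \<open>t \<ge> i - k + 1\<close> follows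
      \<open>t + i \<ge> 2 * a + k + 1 \<ge> n\<close>, so \<open>t\<close> lies between
      \<open>n - i\<close> and its mirror image \<open>i\<close>.\<close>
    ultimately have "n choose (n - i) \<le> n choose t"
      using a by (intro binomial_le_between) auto
    then show ?thesis
      unfolding good_def using greater t \<open>i \<le> n\<close>
      by (intro exI[of _ t]) (simp add: binomial_symmetric[of i n])
  qed
  then obtain f where f: "\<And>i. i \<in> R \<Longrightarrow> good i (f i)"
    by metis
  have "f i < f j" if "i \<in> R" "j \<in> R" "i < j" for i j
  proof -
    have "[int i = int j] (mod int k)" "[int i = int a] (mod int k)" "[int a = int j] (mod int k)"
      using that(1,2) by (auto simp: R_def intro: cong_trans cong_sym)
    then have "i + k \<le> j" "i < a \<longrightarrow> i + k \<le> a" "a < j \<longrightarrow> a + k \<le> j"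
      using sep that(3) by auto
    then show ?thesis
      using f[OF that(1)] f[OF that(2)] that(3) assms(1)
      unfolding good_def by (auto split: if_splits)
  qed
  then have inj: "inj_on f R"
    by (metis inj_onI linorder_neqE_nat less_irrefl)
  have "finite T"
    using assms(2) finite_subset by blast
  have "S n k (int a) = (\<Sum>i\<in>R. n choose i)"
    by (simp add: S_def R_def)
  also have "\<dots> \<le> (\<Sum>i\<in>R. n choose f i)"
    using f by (intro sum_mono) (auto simp: good_def)
  also have "\<dots> = (\<Sum>t\<in>f ` R. n choose t)"
    by (simp add: sum.reindex[OF inj])
  also have "\<dots> \<le> (\<Sum>t\<in>T. n choose t)"
    using f \<open>finite T\<close> by (intro sum_mono2) (auto simp: good_def)
  finally show ?thesis .
qed

text \<open>Integer rounding: the interval of length \<open>\<Sum>c\<close> is cut into consecutive blocks of lengths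
  \<open>c i\<close>. The levels whose block contains a point \<open>\<equiv> \<theta>\<close> modulo \<open>N\<close> form a hitting set for every
  \<open>\<theta>\<close>, and averaging over \<open>\<theta>\<close> gives the claim.\<close>
lemma fractional_hitting_weight_ge:
  fixes b c :: "nat \<Rightarrow> nat"
  assumes cover: "\<And>s. s + k \<le> Suc n \<Longrightarrow> N \<le> (\<Sum>i\<in>{s..<s + k}. c i)"
    and hit: "\<And>T. \<lbrakk>T \<subseteq> {..n}; \<And>s. s + k \<le> Suc n \<Longrightarrow> \<exists>t\<in>T. s \<le> t \<and> t < s + k\<rbrakk>
      \<Longrightarrow> B \<le> (\<Sum>i\<in>T. b i)"
  shows "N * B \<le> (\<Sum>i\<le>n. b i * c i)"
proof -
  \<comment> \<open>Block \<open>i\<close> is the half-open interval from \<open>P i\<close> to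
    \<open>P (Suc i)\<close>.\<close>
  define P where "P i = (\<Sum>j<i. c j)" for i
  define J where "J \<theta> i = {x. P i \<le> x \<and> x < P (Suc i) \<and> x mod N = \<theta>}" for \<theta> i
  define T where "T \<theta> = {i \<in> {..n}. J \<theta> i \<noteq> {}}" for \<theta>
  have fin: "finite (J \<theta> i)" for \<theta> i
    by (rule finite_subset[of _ "{..<P (Suc i)}"]) (auto simp: J_def)
  have B: "B \<le> (\<Sum>i\<in>T \<theta>. b i)" if "\<theta> < N" for \<theta>
  proof (rule hit)
    fix s assume s: "s + k \<le> Suc n"
    have "P (s + k) = P s + (\<Sum>i\<in>{s..<s + k}. c i)"
      unfolding P_def lessThan_atLeast0 by (simp add: sum.atLeastLessThan_concat)
    then have "P s + N \<le> P (s + k)"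
      using cover[OF s] by simp
    moreover have "0 < N"
      using that by simp
    moreover obtain x where x: "P s \<le> x" "x < P s + N" "x mod N = \<theta>"
    proof
      \<comment> \<open>The first number from \<open>P s\<close> on with residue
        \<open>\<theta>\<close>; the added \<open>N\<close> keeps the subtraction from
        truncating.\<close>
      let ?x = "P s + (\<theta> + N - P s mod N) mod N"
      show "P s \<le> ?x" "?x < P s + N"
        using \<open>0 < N\<close> by simp_all
      have "?x mod N = (P s mod N + (\<theta> + N - P s mod N)) mod N"
        by (metis mod_add_left_eq mod_add_right_eq)
      also have "P s mod N + (\<theta> + N - P s mod N) = \<theta> + N"
        using \<open>0 < N\<close> by (simp add: trans_le_add2 less_imp_le)
      finally show "?x mod N = \<theta>"
        using \<open>\<theta> < N\<close> by simp
    qed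
    ultimately have "x < P (s + k)"
      by simp
    \<comment> \<open>Minimality makes \<open>t\<close> the index of the block that contains
      \<open>x\<close>.\<close>
    define t where "t = (LEAST t. x < P (Suc t))"
    have "k > 0"
      using x \<open>x < P (s + k)\<close> by (cases k) auto
    then have "x < P (Suc (s + k - 1))"
      using \<open>x < P (s + k)\<close> by simp
    then have t: "x < P (Suc t)" "t \<le> s + k - 1"
      unfolding t_def by (rule LeastI, rule Least_le)
    have "P t \<le> x"
    proof (cases t)
      case 0
      then show ?thesis by (simp add: P_def)
    next
      case (Suc u)
      then show ?thesis
        using not_less_Least[of u "\<lambda>t. x < P (Suc t)"] unfolding t_def by simp
    qed
    moreover have "s \<le> t"
    proof (rule ccontr)
      assume "\<not> s \<le> t"
      then have "P (Suc t) \<le> P s"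
        unfolding P_def by (intro sum_mono2) auto
      then show False
        using t(1) x(1) by simp
    qed
    ultimately show "\<exists>t\<in>T \<theta>. s \<le> t \<and> t < s + k"
      using t x(3) s \<open>k > 0\<close> by (intro bexI[of _ t]) (auto simp: T_def J_def)
  qed (auto simp: T_def)
  \<comment> \<open>Different residues select disjoint parts of block \<open>i\<close>, whose length
    is \<open>c i\<close>.\<close>
  have card: "(\<Sum>\<theta><N. card (J \<theta> i)) \<le> c i" for i
  proof -
    have "(\<Sum>\<theta><N. card (J \<theta> i)) = card (\<Union>\<theta><N. J \<theta> i)"
      by (intro card_UN_disjoint[symmetric]) (auto simp: fin J_def)
    also have "\<dots> \<le> card {P i..<P (Suc i)}"
      by (intro card_mono) (auto simp: J_def)
    also have "\<dots> = c i"
      by (simp add: P_def)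
    finally show ?thesis .
  qed
  have "N * B = (\<Sum>\<theta><N. B)"
    by simp
  also have "\<dots> \<le> (\<Sum>\<theta><N. \<Sum>i\<in>T \<theta>. b i)"
    using B by (intro sum_mono) auto
  also have "\<dots> \<le> (\<Sum>\<theta><N. \<Sum>i\<le>n. b i * card (J \<theta> i))"
  proof (intro sum_mono)
    fix \<theta>
    have "(\<Sum>i\<in>T \<theta>. b i) \<le> (\<Sum>i\<in>T \<theta>. b i * card (J \<theta> i))"
      using fin by (intro sum_mono) (auto simp: T_def Suc_le_eq card_gt_0_iff)
    also have "\<dots> \<le> (\<Sum>i\<le>n. b i * card (J \<theta> i))"
      by (intro sum_mono2) (auto simp: T_def)
    finally show "(\<Sum>i\<in>T \<theta>. b i) \<le> (\<Sum>i\<le>n. b i * card (J \<theta> i))" .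
  qed
  also have "\<dots> = (\<Sum>i\<le>n. b i * (\<Sum>\<theta><N. card (J \<theta> i)))"
    by (subst sum.swap) (simp add: sum_distrib_left)
  also have "\<dots> \<le> (\<Sum>i\<le>n. b i * c i)"
    using card by (intro sum_mono mult_left_mono) auto
  finally show ?thesis .
qed

section \<open>Random maximal chains\<close>

text \<open>The cardinalities separate the chain members from each other and from \<open>F1\<close>
  and \<open>F2\<close>, so \<open>F1 \<noteq> F2\<close> is the only distinctness left to
  check.\<close>

lemma contains_YI:
  assumes "k \<ge> 2" "F1 \<noteq> F2" "F1 \<in> \<F>" "F2 \<in> \<F>" "\<And>i. i \<in> {1..<k} \<Longrightarrow> G i \<in> \<F>"
    and "\<And>i. 1 \<le> i \<Longrightarrow> i + 1 < k \<Longrightarrow> G i \<subset> G (i + 1)" "G (k - 1) \<subset> F1" "G (k - 1) \<subset> F2"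
    and cards: "card F1 = card F2" "\<And>i. i \<in> {1..<k} \<Longrightarrow> card F1 = card (G i) + (k - i)"
  shows "contains_Y k \<F>"
proof -
  have "inj_on G {1..<k}"
  proof (rule inj_onI)
    fix i j assume "i \<in> {1..<k}" "j \<in> {1..<k}" "G i = G j"
    then show "i = j"
      using cards(2)[of i] cards(2)[of j] by auto
  qed
  have "card (G i) < card F1" if "i \<in> {1..<k}" for i
    using cards(2)[OF that] that by auto
  then have "F1 \<notin> G ` {1..<k}" "F2 \<notin> G ` {1..<k}"
    using cards(1) by (metis imageE less_irrefl)+
  then have "distinct (F1 # F2 # map G [1..<k])"
    using assms(2) \<open>inj_on G {1..<k}\<close> by (simp add: distinct_map)
  with assms show ?thesis
    unfolding contains_Y_def by (intro exI[of _ F1] exI[of _ F2] exI[of _ G]) auto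
qed

lemma contains_Y'I:
  assumes "k \<ge> 2" "F1 \<noteq> F2" "F1 \<in> \<F>" "F2 \<in> \<F>" "\<And>i. i \<in> {1..<k} \<Longrightarrow> G i \<in> \<F>"
    and "\<And>i. 1 \<le> i \<Longrightarrow> i + 1 < k \<Longrightarrow> G (i + 1) \<subset> G i" "F1 \<subset> G (k - 1)" "F2 \<subset> G (k - 1)"
    and cards: "card F1 = card F2" "\<And>i. i \<in> {1..<k} \<Longrightarrow> card (G i) = card F1 + (k - i)"
  shows "contains_Y' k \<F>"
proof -
  have "inj_on G {1..<k}"
  proof (rule inj_onI)
    fix i j assume "i \<in> {1..<k}" "j \<in> {1..<k}" "G i = G j"
    then show "i = j"
      using cards(2)[of i] cards(2)[of j] by auto
  qed
  have "card F1 < card (G i)" if "i \<in> {1..<k}" for i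
    using cards(2)[OF that] that by auto
  then have "F1 \<notin> G ` {1..<k}" "F2 \<notin> G ` {1..<k}"
    using cards(1) by (metis imageE less_irrefl)+
  then have "distinct (F1 # F2 # map G [1..<k])"
    using assms(2) \<open>inj_on G {1..<k}\<close> by (simp add: distinct_map)
  with assms show ?thesis
    unfolding contains_Y'_def by (intro exI[of _ F1] exI[of _ F2] exI[of _ G]) auto
qed

section \<open>Distribution of the members of a random chain\<close>

lemma ex_permutes_prefix:
  assumes "H \<subseteq> {1..n}"
  obtains \<sigma> where "\<sigma> permutes {1..n}" "\<sigma> ` {1..card H} = H"
proof -
  have fin: "finite H"
    using assms finite_subset by blast
  have le: "card H \<le> n"
    using assms card_mono[of "{1..n}" H] by simp
  obtain f where f: "bij_betw f {1..card H} H"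
    using fin by (metis bij_betw_iff_card card_atLeastAtMost diff_Suc_1 finite_atLeastAtMost)
  have "card ({1..n} - {1..card H}) = card ({1..n} - H)"
    using assms fin le by (simp add: card_Diff_subset)
  then obtain g where g: "bij_betw g ({1..n} - {1..card H}) ({1..n} - H)"
    using bij_betw_iff_card[of "{1..n} - {1..card H}" "{1..n} - H"] by auto
  define h where "h x = (if x \<in> {1..card H} then f x else if x \<in> {1..n} then g x else x)" for x
  have h: "bij_betw h {1..card H} H" "bij_betw h ({1..n} - {1..card H}) ({1..n} - H)"
    using f g by (auto simp: h_def intro: iffD1[OF bij_betw_cong, rotated])
  from bij_betw_combine[OF this] have "bij_betw h {1..n} {1..n}"
    using assms le by (simp add: Un_absorb1)
  then have "h permutes {1..n}"
    using le by (intro bij_imp_permutes) (auto simp: h_def)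
  with h(1) show ?thesis
    by (intro that) (auto simp: bij_betw_def)
qed

text \<open>For \<open>i \<le> n\<close> the image of \<open>{1..i}\<close> is uniform among the
  \<open>i\<close>-sets: composition with a permutation that maps \<open>{1..i}\<close> onto
  \<open>H\<close> matches the fibre over \<open>{1..i}\<close> with the fibre over
  \<open>H\<close>. The product form avoids division.\<close>

lemma card_permutes_prefix_in:
  assumes "\<H> \<subseteq> {H. H \<subseteq> {1..n} \<and> card H = i}"
  shows "(n choose i) * card {\<pi>. \<pi> permutes {1..n} \<and> \<pi> ` {1..i} \<in> \<H>} = fact n * card \<H>"
proof (cases "i \<le> n")
  case False
  have "card H \<le> n" if "H \<subseteq> {1..n}" for H
    using card_mono[OF _ that] by simp
  then have "\<H> = {}"
    using assms False by auto
  then show ?thesis by simp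
next
  case True
  define cnt where "cnt H = card {\<pi>. \<pi> permutes {1..n} \<and> \<pi> ` {1..i} = H}" for H
  have cnt: "cnt H = cnt {1..i}" if H: "H \<subseteq> {1..n}" "card H = i" for H
  proof -
    obtain \<sigma> where \<sigma>: "\<sigma> permutes {1..n}" "\<sigma> ` {1..i} = H"
      using ex_permutes_prefix[OF H(1)] H(2) by auto
    have "(\<sigma> \<circ> \<pi>) ` {1..i} = H \<longleftrightarrow> \<pi> ` {1..i} = {1..i}" for \<pi>
      using \<sigma> by (metis image_comp inj_image_eq_iff permutes_inj)
    then have "(\<Sum>\<pi> | \<pi> permutes {1..n}. of_bool (\<pi> ` {1..i} = H) :: nat) =
        (\<Sum>\<pi> | \<pi> permutes {1..n}. of_bool (\<pi> ` {1..i} = {1..i}))"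
      by (subst setum_permutations_compose_left[OF \<sigma>(1)]) simp
    then show ?thesis
      by (simp add: cnt_def finite_permutations Collect_conj_eq)
  qed
  have count: "card {\<pi>. \<pi> permutes {1..n} \<and> \<pi> ` {1..i} \<in> \<H>'} = card \<H>' * cnt {1..i}"
    if "\<H>' \<subseteq> {H. H \<subseteq> {1..n} \<and> card H = i}" for \<H>'
  proof -
    have "finite \<H>'"
      using that by (rule finite_subset) auto
    have "{\<pi>. \<pi> permutes {1..n} \<and> \<pi> ` {1..i} \<in> \<H>'} =
        (\<Union>H\<in>\<H>'. {\<pi>. \<pi> permutes {1..n} \<and> \<pi> ` {1..i} = H})"
      by auto
    also have "card \<dots> = (\<Sum>H\<in>\<H>'. cnt H)"
      unfolding cnt_def using \<open>finite \<H>'\<close>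
      by (intro card_UN_disjoint) (auto intro: finite_subset[OF _ finite_permutations])
    also have "\<dots> = card \<H>' * cnt {1..i}"
      using cnt that by (simp add: subset_iff)
    finally show ?thesis .
  qed
  have "\<pi> ` {1..i} \<in> {H. H \<subseteq> {1..n} \<and> card H = i}" if "\<pi> permutes {1..n}" for \<pi>
    using that True permutes_image[OF that]
    by (auto simp: card_image permutes_inj_on)
  then have "{\<pi>. \<pi> permutes {1..n} \<and> \<pi> ` {1..i} \<in> {H. H \<subseteq> {1..n} \<and> card H = i}} =
      {\<pi>. \<pi> permutes {1..n}}"
    by blast
  \<comment> \<open>Applied to all \<open>i\<close>-sets, the count determines the common fibre
    size.\<close>
  with count[of "{H. H \<subseteq> {1..n} \<and> card H = i}"] have "fact n = (n choose i) * cnt {1..i}"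
    by (simp add: card_permutations n_subsets)
  with count[OF assms] show ?thesis
    by simp
qed

text \<open>The probability \<open>\<mu>\<^sub>i\<close> multiplied by \<open>fact n\<close>; counts
  keep the estimates in the natural numbers.\<close>

definition misses :: "nat \<Rightarrow> nat set set \<Rightarrow> nat \<Rightarrow> nat" where
  "misses n \<F> i = card {\<pi>. \<pi> permutes {1..n} \<and> \<pi> ` {1..i} \<notin> \<F>}"

lemma misses_eq:
  assumes "i \<le> n"
  shows "(n choose i) * misses n \<F> i = fact n * card {H \<in> Pow {1..n} - \<F>. card H = i}"
proof -
  have "\<pi> ` {1..i} \<subseteq> {1..n}" "card (\<pi> ` {1..i}) = i" if "\<pi> permutes {1..n}" for \<pi>
    using that assms permutes_image[OF that]
    by (auto simp: card_image permutes_inj_on)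
  then have eq: "misses n \<F> i =
      card {\<pi>. \<pi> permutes {1..n} \<and> \<pi> ` {1..i} \<in> {H \<in> Pow {1..n} - \<F>. card H = i}}"
    unfolding misses_def by (intro arg_cong[where f = card]) auto
  show ?thesis
    unfolding eq by (rule card_permutes_prefix_in) auto
qed

text \<open>Weighting each level by its number of sets turns miss probabilities into numbers of
  missing sets.\<close>

lemma sum_misses:
  "(\<Sum>i\<le>n. (n choose i) * misses n \<F> i) = fact n * card (Pow {1..n} - \<F>)"
proof -
  have "card H \<le> n" if "H \<subseteq> {1..n}" for H
    using card_mono[OF _ that] by simp
  then have "Pow {1..n} - \<F> = (\<Union>i\<le>n. {H \<in> Pow {1..n} - \<F>. card H = i})"
    by auto
  also have "card \<dots> = (\<Sum>i\<le>n. card {H \<in> Pow {1..n} - \<F>. card H = i})"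
    by (intro card_UN_disjoint) auto
  finally have "fact n * card (Pow {1..n} - \<F>) =
      (\<Sum>i\<le>n. fact n * card {H \<in> Pow {1..n} - \<F>. card H = i})"
    by (simp add: sum_distrib_left)
  also have "\<dots> = (\<Sum>i\<le>n. (n choose i) * misses n \<F> i)"
    by (intro sum.cong) (simp_all add: misses_eq)
  finally show ?thesis by simp
qed

text \<open>\<open>A\<close> and \<open>B\<close> are the missing exchange partners at the bottom and at the top of a window.\<close>
lemma card_product_ge:
  fixes J L :: "'a set"
  assumes "finite J" "finite L" "J \<noteq> {}" "L \<noteq> {}" "A \<subseteq> J" "B \<subseteq> L"
    and up: "A \<noteq> J \<Longrightarrow> card (L - B) \<le> 1" and down: "B \<noteq> L \<Longrightarrow> card (J - A) \<le> 1"
  shows "min (card J * card L) (2 * card J * card L - card J - card L)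
    \<le> card L * card A + card J * card B"
proof (cases "A = J \<or> B = L")
  case True
  then show ?thesis by (auto simp: mult.commute)
next
  case False
  have "finite A" "finite B"
    using assms finite_subset by auto
  \<comment> \<open>Some partner survives at each end, so \<open>up\<close> and \<open>down\<close>
    both apply.\<close>
  then have "card J - 1 \<le> card A" "card L - 1 \<le> card B"
    using False up down assms by (auto simp: card_Diff_subset)
  then have "card L * (card J - 1) + card J * (card L - 1) \<le> card L * card A + card J * card B"
    by (intro add_mono mult_left_mono) auto
  moreover have "card J * 1 \<le> card J * card L" "1 * card L \<le> card J * card L"
    using assms by (intro mult_le_mono; simp add: Suc_le_eq card_gt_0_iff)+
  moreover have "card L * (card J - 1) = card J * card L - card L"
    "card J * (card L - 1) = card J * card L - card J"
    by (simp_all add: diff_mult_distrib2 mult.commute)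
  ultimately show ?thesis
    by linarith
qed

section \<open>Exchanging the two ends of a window\<close>

text \<open>A surviving bottom set and the middle of the chain form \<open>G 1\<close>, ...,
  \<open>G (k - 1)\<close>; two surviving top sets would complete a copy of
  \<open>Y\<^sub>k\<close>.\<close>

lemma window_exchange_Y:
  assumes "k \<ge> 3" "s + k \<le> Suc n" and \<pi>: "\<pi> permutes {1..n}" and noY: "\<not> contains_Y k \<F>"
    and mid: "\<And>i. s < i \<Longrightarrow> i + 1 < s + k \<Longrightarrow> \<pi> ` {1..i} \<in> \<F>"
    and j: "j \<in> {1..s + 1}" "\<pi> ` ({1..s + 1} - {j}) \<in> \<F>"
  shows "card {l \<in> {s + k - 1..n}. \<pi> ` insert l {1..s + k - 2} \<in> \<F>} \<le> 1"
proof (rule ccontr)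
  assume "\<not> ?thesis"
  then obtain l l' where l: "l \<noteq> l'"
    and L: "\<And>x. x \<in> {l, l'} \<Longrightarrow> x \<in> {s + k - 1..n} \<and> \<pi> ` insert x {1..s + k - 2} \<in> \<F>"
    by (auto simp: card_le_Suc0_iff_eq)
  \<comment> \<open>The sizes run from \<open>s\<close> to \<open>s + k - 2\<close>. Only
    \<open>G 1\<close> feels the exchange, since the later prefixes contain both \<open>j\<close>
    and \<open>s + 1\<close>.\<close>
  define G where "G i = \<pi> ` (if i = 1 then {1..s + 1} - {j} else {1..s + i - 1})" for i
  note inj = permutes_inj[OF \<pi>]
  have card: "card (\<pi> ` X) = card X" for X
    by (intro card_image) (use inj inj_on_subset in blast)
  have ins: "card (insert x {1..s + k - 2}) = s + k - 1" if "x \<in> {l, l'}" for x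
    using L[OF that] assms(1) by (subst card_insert_disjoint) auto
  have psub: "\<pi> ` X \<subset> \<pi> ` Y \<longleftrightarrow> X \<subset> Y" for X Y
    using inj by (simp add: psubset_eq inj_image_subset_iff inj_image_eq_iff)
  have new: "x \<notin> {1..s + k - 2}" if "x \<in> {l, l'}" for x
    using L[OF that] assms(1) by auto
  have top: "{1..s + k - 2} \<subset> insert x {1..s + k - 2}" if "x \<in> {l, l'}" for x
    using new[OF that] by blast
  have "contains_Y k \<F>"
  proof (rule contains_YI)
    show "\<pi> ` insert l {1..s + k - 2} \<noteq> \<pi> ` insert l' {1..s + k - 2}"
    proof
      assume "\<pi> ` insert l {1..s + k - 2} = \<pi> ` insert l' {1..s + k - 2}"
      then have "insert l {1..s + k - 2} = insert l' {1..s + k - 2}"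
        using inj by (simp only: inj_image_eq_iff)
      then have "l \<in> insert l' {1..s + k - 2}"
        by blast
      then show False
        using l new[of l] by simp
    qed
  next
    fix i assume i: "i \<in> {1..<k}"
    show "G i \<in> \<F>"
    proof (cases "i = 1")
      case False
      then have "s < s + i - 1" "s + i - 1 + 1 < s + k"
        using i by auto
      then show ?thesis
        using mid False by (simp add: G_def)
    qed (use j(2) in \<open>simp add: G_def\<close>)
    have "card (G i) = s + i - 1"
      using i j(1) unfolding G_def card by (cases "i = 1") simp_all
    then show "card (\<pi> ` insert l {1..s + k - 2}) = card (G i) + (k - i)"
      using i ins[of l] unfolding card by simp
  next
    fix i assume i: "1 \<le> i" "i + 1 < k"
    show "G i \<subset> G (i + 1)"
    proof (cases "i = 1")
      case True
      then have G: "G i = \<pi> ` ({1..s + 1} - {j})" "G (i + 1) = \<pi> ` {1..s + 1}"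
        by (simp_all add: G_def)
      show ?thesis
        unfolding G psub using j(1) by blast
    next
      case False
      then have G: "G i = \<pi> ` {1..s + i - 1}" "G (i + 1) = \<pi> ` {1..s + i}"
        using i by (simp_all add: G_def)
      show ?thesis
        unfolding G psub using i by (simp add: atLeastatMost_psubset_iff)
    qed
  next
    have "G (k - 1) = \<pi> ` {1..s + k - 2}"
      using assms(1) by (simp add: G_def numeral_2_eq_2)
    then show "G (k - 1) \<subset> \<pi> ` insert l {1..s + k - 2}" "G (k - 1) \<subset> \<pi> ` insert l' {1..s + k - 2}"
      using top by (simp_all only: psub insert_iff simp_thms)
  next
    show "card (\<pi> ` insert l {1..s + k - 2}) = card (\<pi> ` insert l' {1..s + k - 2})"
      unfolding card using ins by simp
  qed (use assms(1) L in simp_all)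
  with noY show False ..
qed

text \<open>The order dual: the chain is read downwards from a surviving top set, and two surviving
  bottom sets would complete it.\<close>

lemma window_exchange_Y':
  assumes "k \<ge> 3" "s + k \<le> Suc n" and \<pi>: "\<pi> permutes {1..n}" and noY': "\<not> contains_Y' k \<F>"
    and mid: "\<And>i. s < i \<Longrightarrow> i + 1 < s + k \<Longrightarrow> \<pi> ` {1..i} \<in> \<F>"
    and l: "l \<in> {s + k - 1..n}" "\<pi> ` insert l {1..s + k - 2} \<in> \<F>"
  shows "card {j \<in> {1..s + 1}. \<pi> ` ({1..s + 1} - {j}) \<in> \<F>} \<le> 1"
proof (rule ccontr)
  assume "\<not> ?thesis"
  then obtain j j' where j: "j \<noteq> j'"
    and J: "{j, j'} \<subseteq> {1..s + 1}" "\<pi> ` ({1..s + 1} - {j}) \<in> \<F>" "\<pi> ` ({1..s + 1} - {j'}) \<in> \<F>"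
    by (auto simp: card_le_Suc0_iff_eq)
  define G where "G i = \<pi> ` (if i = 1 then insert l {1..s + k - 2} else {1..s + k - i})" for i
  note inj = permutes_inj[OF \<pi>]
  have card: "card (\<pi> ` X) = card X" for X
    by (intro card_image) (use inj inj_on_subset in blast)
  have ins: "card (insert l {1..s + k - 2}) = s + k - 1"
    using l assms(1) by (subst card_insert_disjoint) auto
  have psub: "\<pi> ` X \<subset> \<pi> ` Y \<longleftrightarrow> X \<subset> Y" for X Y
    using inj by (simp add: psubset_eq inj_image_subset_iff inj_image_eq_iff)
  have bot: "{1..s + 1} - {x} \<subset> {1..s + 1}" "card ({1..s + 1} - {x}) = s" if "x \<in> {j, j'}" for x
  proof -
    have "x \<in> {1..s + 1}"
      using J(1) that by blast
    then show "{1..s + 1} - {x} \<subset> {1..s + 1}" "card ({1..s + 1} - {x}) = s"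
      by (blast, simp only: card_Diff_singleton card_atLeastAtMost add_diff_cancel_right' if_True)
  qed
  have "contains_Y' k \<F>"
  proof (rule contains_Y'I)
    show "\<pi> ` ({1..s + 1} - {j}) \<noteq> \<pi> ` ({1..s + 1} - {j'})"
    proof
      assume "\<pi> ` ({1..s + 1} - {j}) = \<pi> ` ({1..s + 1} - {j'})"
      then have "{1..s + 1} - {j} = {1..s + 1} - {j'}"
        using inj by (simp only: inj_image_eq_iff)
      then show False
        using j J(1) by blast
    qed
  next
    fix i assume i: "i \<in> {1..<k}"
    show "G i \<in> \<F>"
    proof (cases "i = 1")
      case False
      then have "s < s + k - i" "s + k - i + 1 < s + k"
        using i by auto
      then show ?thesis
        using mid False by (simp add: G_def)
    qed (use l(2) in \<open>simp add: G_def\<close>)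
    have "card (G i) = s + k - i"
      using i ins unfolding G_def card by (cases "i = 1") simp_all
    then show "card (G i) = card (\<pi> ` ({1..s + 1} - {j})) + (k - i)"
      using i bot(2)[of j] unfolding card by simp
  next
    fix i assume i: "1 \<le> i" "i + 1 < k"
    show "G (i + 1) \<subset> G i"
    proof (cases "i = 1")
      case True
      then have G: "G i = \<pi> ` insert l {1..s + k - 2}" "G (i + 1) = \<pi> ` {1..s + k - 2}"
        by (simp_all add: G_def numeral_2_eq_2)
      have "l \<notin> {1..s + k - 2}"
        using l(1) assms(1) by auto
      then show ?thesis
        unfolding G psub by blast
    next
      case False
      then have G: "G i = \<pi> ` {1..s + k - i}" "G (i + 1) = \<pi> ` {1..s + k - (i + 1)}"
        using i by (simp_all add: G_def)
      show ?thesis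
        unfolding G psub atLeastatMost_psubset_iff using i by auto
    qed
  next
    have "G (k - 1) = \<pi> ` {1..s + 1}"
      using assms(1) by (simp add: G_def)
    then show "\<pi> ` ({1..s + 1} - {j}) \<subset> G (k - 1)" "\<pi> ` ({1..s + 1} - {j'}) \<subset> G (k - 1)"
      using bot by (simp_all only: psub insert_iff simp_thms)
  next
    show "card (\<pi> ` ({1..s + 1} - {j})) = card (\<pi> ` ({1..s + 1} - {j'}))"
      unfolding card using bot by simp
  qed (use assms(1) J(2,3) in simp_all)
  with noY' show False ..
qed

text \<open>The two transpositions change only the lowest and the highest set of the window. Each
  summand is thus a bottom indicator plus a common middle part plus a top indicator.\<close>

lemma window_misses_exchange:
  assumes "k \<ge> 3" "s + k \<le> Suc n" and \<pi>: "\<pi> permutes {1..n}"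
    and no: "\<not> contains_Y k \<F>" "\<not> contains_Y' k \<F>"
  defines "a \<equiv> s + 1" and "d \<equiv> n + 2 - (s + k)"
  shows "min (a * d) (2 * a * d - a - d) \<le>
    (\<Sum>j\<in>{1..s + 1}. \<Sum>l\<in>{s + k - 1..n}. \<Sum>i\<in>{s..<s + k}.
      of_bool ((\<pi> \<circ> (transpose j (s + 1) \<circ> transpose l (s + k - 1))) ` {1..i} \<notin> \<F>))"
proof -
  let ?J = "{1..s + 1}" and ?L = "{s + k - 1..n}"
  define x where "x j = (of_bool (\<pi> ` ({1..s + 1} - {j}) \<notin> \<F>) :: nat)" for j
  define y where "y l = (of_bool (\<pi> ` insert l {1..s + k - 2} \<notin> \<F>) :: nat)" for l
  define z where "z = (\<Sum>i\<in>{s<..<s + k - 1}. of_bool (\<pi> ` {1..i} \<notin> \<F>) :: nat)"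
  have cards: "card ?J = a" "card ?L = d"
    using assms(1,2) by (simp_all add: a_def d_def)
  have inner: "(\<Sum>i\<in>{s..<s + k}.
      of_bool ((\<pi> \<circ> (transpose j (s + 1) \<circ> transpose l (s + k - 1))) ` {1..i} \<notin> \<F>)) = x j + z + y l"
    (is "(\<Sum>i\<in>_. ?g i) = _") if j: "j \<in> ?J" and l: "l \<in> ?L" for j l
  proof -
    have fix_l: "transpose l (s + k - 1) ` {1..i} = {1..i}" if "i < s + k - 1" for i
      by (rule transpose_image_eq[THEN trans]) (use l that in auto)
    have fix_j: "transpose j (s + 1) ` {1..i} = {1..i}" if "s < i" for i
      by (rule transpose_image_eq[THEN trans]) (use j that in auto)
    have at_j: "transpose j (s + 1) ` {1..s} = {1..s + 1} - {j}"
      using j by (auto simp: transpose_def image_iff split: if_splits)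
    have at_l: "transpose l (s + k - 1) ` {1..s + k - 1} = insert l {1..s + k - 2}"
      using l assms(1) by (auto simp: transpose_def image_iff split: if_splits)
    have "transpose j (s + 1) l = l"
      using j l assms(1) by (intro transpose_apply_other) auto
    then have "transpose j (s + 1) ` insert l {1..s + k - 2} = insert l {1..s + k - 2}"
      using fix_j[of "s + k - 2"] assms(1) by (simp only: image_insert)
    then have top: "?g (s + k - 1) = y l"
      by (simp only: image_comp[symmetric] at_l y_def)
    have "transpose l (s + k - 1) ` {1..s} = {1..s}"
      using assms(1) by (intro fix_l) simp
    then have bot: "?g s = x j"
      by (simp only: image_comp[symmetric] at_j x_def)
    have "?g i = of_bool (\<pi> ` {1..i} \<notin> \<F>)" if "i \<in> {s<..<s + k - 1}" for i
      using that fix_l[of i] fix_j[of i] by (simp only: image_comp[symmetric]) simp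
    then have mid: "(\<Sum>i\<in>{s<..<s + k - 1}. ?g i) = z"
      unfolding z_def by (intro sum.cong) auto
    have "{s..<s + k} = insert s (insert (s + k - 1) {s<..<s + k - 1})"
      using assms(1) by auto
    then have "(\<Sum>i\<in>{s..<s + k}. ?g i) = ?g s + (?g (s + k - 1) + (\<Sum>i\<in>{s<..<s + k - 1}. ?g i))"
      using assms(1) by (simp only:) (subst sum.insert; simp)+
    then show ?thesis
      using top bot mid by simp
  qed
  \<comment> \<open>If the middle part is positive, each of the \<open>a * d\<close> summands is at
    least 1. Otherwise the middle lies in \<open>\<F>\<close> and the exchange lemmas supply the
    hypotheses of \<open>card_product_ge\<close>.\<close>
  have "min (a * d) (2 * a * d - a - d) \<le> (\<Sum>j\<in>?J. \<Sum>l\<in>?L. x j + z + y l)"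
  proof (cases "z = 0")
    case False
    then have "(\<Sum>j\<in>?J. \<Sum>l\<in>?L. 1) \<le> (\<Sum>j\<in>?J. \<Sum>l\<in>?L. x j + z + y l)"
      by (intro sum_mono) auto
    then have "a * d \<le> (\<Sum>j\<in>?J. \<Sum>l\<in>?L. x j + z + y l)"
      by (simp only: sum_constant cards of_nat_id mult_1_right)
    then show ?thesis
      by (rule min.coboundedI1)
  next
    case True
    have mid: "\<pi> ` {1..i} \<in> \<F>" if "s < i" "i + 1 < s + k" for i
    proof -
      have "i \<in> {s<..<s + k - 1}"
        using that by simp
      then have "(of_bool (\<pi> ` {1..i} \<notin> \<F>) :: nat) = 0"
        using True unfolding z_def by (subst (asm) sum_eq_0_iff) blast+
      then show ?thesis by simp
    qed
    define A where "A = ?J \<inter> {j. \<pi> ` ({1..s + 1} - {j}) \<notin> \<F>}"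
    define B where "B = ?L \<inter> {l. \<pi> ` insert l {1..s + k - 2} \<notin> \<F>}"
    have diff: "X - X \<inter> {i. Q i \<notin> \<F>} = {i \<in> X. Q i \<in> \<F>}" for X :: "nat set" and Q
      by blast
    have "min (card ?J * card ?L) (2 * card ?J * card ?L - card ?J - card ?L)
        \<le> card ?L * card A + card ?J * card B"
    proof (rule card_product_ge)
      assume "A \<noteq> ?J"
      moreover have "A \<subseteq> ?J"
        by (auto simp: A_def)
      ultimately obtain j where "j \<in> ?J" "j \<notin> A"
        by blast
      then have "j \<in> ?J" "\<pi> ` ({1..s + 1} - {j}) \<in> \<F>"
        unfolding A_def by blast+
      from window_exchange_Y[OF assms(1,2) \<pi> no(1) mid this]
      show "card (?L - B) \<le> 1"
        unfolding B_def diff .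
    next
      assume "B \<noteq> ?L"
      moreover have "B \<subseteq> ?L"
        by (auto simp: B_def)
      ultimately obtain l where "l \<in> ?L" "l \<notin> B"
        by blast
      then have "l \<in> ?L" "\<pi> ` insert l {1..s + k - 2} \<in> \<F>"
        unfolding B_def by blast+
      from window_exchange_Y'[OF assms(1,2) \<pi> no(2) mid this]
      show "card (?J - A) \<le> 1"
        unfolding A_def diff .
    qed (use assms(1,2) in \<open>auto simp: A_def B_def\<close>)
    also have "card ?L * card A + card ?J * card B = (\<Sum>j\<in>?J. \<Sum>l\<in>?L. x j + z + y l)"
    proof -
      have "(\<Sum>j\<in>?J. x j) = card A" "(\<Sum>l\<in>?L. y l) = card B"
        by (simp_all only: x_def y_def A_def B_def sum_of_bool_eq finite_atLeastAtMost of_nat_id)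
      then show ?thesis
        using True by (simp only: sum.distrib sum_constant sum_distrib_left[symmetric] of_nat_id add_0_right)
    qed
    finally show ?thesis
      by (simp only: cards)
  qed
  also have "\<dots> = (\<Sum>j\<in>?J. \<Sum>l\<in>?L. \<Sum>i\<in>{s..<s + k}.
      of_bool ((\<pi> \<circ> (transpose j (s + 1) \<circ> transpose l (s + k - 1))) ` {1..i} \<notin> \<F>))"
    by (intro sum.cong refl inner[symmetric])
  finally show ?thesis .
qed

text \<open>Summation over all \<open>\<pi>\<close>: composition with a fixed permutation is a
  bijection on the permutations, so all \<open>a * d\<close> pairs contribute the same
  total.\<close>

lemma window_misses_ge:
  assumes "k \<ge> 3" "s + k \<le> Suc n" and no: "\<not> contains_Y k \<F>" "\<not> contains_Y' k \<F>"
  defines "a \<equiv> s + 1" and "d \<equiv> n + 2 - (s + k)"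
  shows "fact n * min (a * d) (2 * a * d - a - d) \<le> a * d * (\<Sum>i\<in>{s..<s + k}. misses n \<F> i)"
proof -
  let ?P = "{\<pi>. \<pi> permutes {1..n}}"
  define q where "q j l = transpose j (s + 1) \<circ> transpose l (s + k - 1)" for j l
  have W: "(\<Sum>i\<in>{s..<s + k}. misses n \<F> i) =
      (\<Sum>\<pi>\<in>?P. \<Sum>i\<in>{s..<s + k}. of_bool ((\<pi> \<circ> q j l) ` {1..i} \<notin> \<F>))"
    if "j \<in> {1..s + 1}" "l \<in> {s + k - 1..n}" for j l
  proof -
    have "q j l permutes {1..n}"
      unfolding q_def using that assms(1,2) by (intro permutes_compose permutes_swap_id) auto
    then have "(\<Sum>\<pi>\<in>?P. \<Sum>i\<in>{s..<s + k}. of_bool ((\<pi> \<circ> q j l) ` {1..i} \<notin> \<F>) :: nat) =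
        (\<Sum>\<pi>\<in>?P. \<Sum>i\<in>{s..<s + k}. of_bool (\<pi> ` {1..i} \<notin> \<F>))"
      by (rule sum_permutations_compose_right[symmetric])
    also have "\<dots> = (\<Sum>i\<in>{s..<s + k}. \<Sum>\<pi>\<in>?P. of_bool (\<pi> ` {1..i} \<notin> \<F>))"
      by (rule sum.swap)
    also have "\<dots> = (\<Sum>i\<in>{s..<s + k}. misses n \<F> i)"
      by (simp add: misses_def finite_permutations Collect_conj_eq)
    finally show ?thesis ..
  qed
  have "fact n * min (a * d) (2 * a * d - a - d) = (\<Sum>\<pi>\<in>?P. min (a * d) (2 * a * d - a - d))"
    by (simp add: card_permutations)
  also have "\<dots> \<le> (\<Sum>\<pi>\<in>?P. \<Sum>j\<in>{1..s + 1}. \<Sum>l\<in>{s + k - 1..n}. \<Sum>i\<in>{s..<s + k}.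
      of_bool ((\<pi> \<circ> q j l) ` {1..i} \<notin> \<F>))"
    unfolding q_def a_def d_def
    using window_misses_exchange[OF assms(1,2) _ no] by (intro sum_mono) blast
  also have "\<dots> = (\<Sum>j\<in>{1..s + 1}. \<Sum>l\<in>{s + k - 1..n}. \<Sum>\<pi>\<in>?P. \<Sum>i\<in>{s..<s + k}.
      of_bool ((\<pi> \<circ> q j l) ` {1..i} \<notin> \<F>))"
    by (subst sum.swap) (intro sum.cong refl sum.swap)
  also have "\<dots> = (\<Sum>j\<in>{1..s + 1}. \<Sum>l\<in>{s + k - 1..n}. \<Sum>i\<in>{s..<s + k}. misses n \<F> i)"
    using W by (intro sum.cong refl) simp
  also have "\<dots> = a * d * (\<Sum>i\<in>{s..<s + k}. misses n \<F> i)"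
  proof -
    have "card {1..s + 1} = a" "card {s + k - 1..n} = d"
      using assms(1,2) by (simp_all add: a_def d_def)
    then show ?thesis
      by (simp only: sum_constant of_nat_id mult.assoc)
  qed
  finally show ?thesis .
qed

section \<open>The extremal number\<close>

lemma card_Pow_minus_ge:
  assumes k: "3 \<le> k" "k \<le> n" and sub: "\<F> \<subseteq> Pow {1..n}"
    and no: "\<not> contains_Y k \<F>" "\<not> contains_Y' k \<F>"
    and m: "int n - int k \<le> 2 * m" "2 * m \<le> int n - int k + 1"
  shows "S n k m \<le> card (Pow {1..n} - \<F>)"
proof -
  define M where "M = card (Pow {1..n} - \<F>)"
  define c where "c = misses n \<F>"
  define N where "N = (fact n :: nat)"
  define W where "W s = (\<Sum>i\<in>{s..<s + k}. c i)" for s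
  define d where "d = n + 2 - k"
  have "N > 0" and "d \<ge> 2"
    using k by (simp_all add: N_def d_def)
  have inner: "N \<le> W s" if "1 \<le> s" "s + k \<le> n" for s
  proof -
    define a e where "a = s + 1" and "e = n + 2 - (s + k)"
    have "2 \<le> a" "2 \<le> e"
      using that by (auto simp: a_def e_def)
    then obtain a' e' where ae: "a = a' + 2" "e = e' + 2"
      by (metis add.commute le_iff_add)
    \<comment> \<open>Equivalent to \<open>(a - 1) * (e - 1) \<ge> 1\<close>; it makes
      \<open>a * e\<close> the minimum in the window bound.\<close>
    have "a * e \<le> 2 * a * e - a - e"
      unfolding ae by (simp add: algebra_simps)
    then have "a * e * N \<le> a * e * W s"
      using window_misses_ge[of k s n \<F>] k that no
      by (simp add: N_def W_def c_def a_def e_def min_absorb1 mult.commute[of "fact n"]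
          del: One_nat_def)
    moreover have "0 < a * e"
      unfolding ae by simp
    ultimately show ?thesis
      by (simp only: mult_le_cancel1)
  qed
  \<comment> \<open>Here one end has a single exchange choice and the other has \<open>d\<close>, so
    the window falls short of \<open>N\<close> by at most \<open>N / d\<close>.\<close>
  have ends: "N * (d - 1) \<le> d * W 0" "N * (d - 1) \<le> d * W (n + 1 - k)"
  proof -
    have "min (1 * d) (2 * 1 * d - 1 - d) = d - 1" "min (d * 1) (2 * d * 1 - d - 1) = d - 1"
      using \<open>d \<ge> 2\<close> by auto
    then show "N * (d - 1) \<le> d * W 0" "N * (d - 1) \<le> d * W (n + 1 - k)"
      using window_misses_ge[of k 0 n \<F>] window_misses_ge[of k "n + 1 - k" n \<F>] k no
      by (simp_all add: N_def W_def c_def d_def Suc_diff_le)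
  qed
  have total: "(\<Sum>i\<le>n. (n choose i) * c i) = N * M"
    unfolding c_def N_def M_def by (rule sum_misses)
  show ?thesis
  proof (cases "n = k")
    case False
    \<comment> \<open>The repair adds the deficiency of each end window, truncated to 0 if there is
      none. Levels \<open>0\<close> and \<open>n\<close> have binomial coefficient 1, so this is
      also its cost.\<close>
    define c' where "c' i = c i + (if i = 0 then N - W 0 else 0) + (if i = n then N - W (n + 1 - k) else 0)" for i
    have W': "(\<Sum>i\<in>{s..<s + k}. c' i) = W s + (if s = 0 then N - W 0 else 0) +
        (if s = n + 1 - k then N - W (n + 1 - k) else 0)" if "s + k \<le> Suc n" for s
      using that k by (auto simp: c'_def W_def sum.distrib)
    have "N * S n k m \<le> (\<Sum>i\<le>n. (n choose i) * c' i)"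
    proof (rule fractional_hitting_weight_ge)
      fix s assume s: "s + k \<le> Suc n"
      show "N \<le> (\<Sum>i\<in>{s..<s + k}. c' i)"
        using W'[OF s] inner[of s] s by (cases "s = 0"; cases "s = n + 1 - k") auto
    next
      fix T assume T: "T \<subseteq> {..n}" "\<And>s. s + k \<le> Suc n \<Longrightarrow> \<exists>t\<in>T. s \<le> t \<and> t < s + k"
      have "m \<ge> 0"
        using m k by linarith
      moreover have "nat m + k \<le> Suc n"
        using m k by linarith
      ultimately obtain t where t: "t \<in> T" "nat m \<le> t" "t < nat m + k"
        using T(2)[of "nat m"] by auto
      \<comment> \<open>The window starting at \<open>m\<close> is centred at \<open>n / 2\<close>
        up to rounding, and none of its members is farther from \<open>n / 2\<close> than
        \<open>m\<close>.\<close>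
      then have "S n k m \<le> S n k (int t)"
        using \<open>m \<ge> 0\<close> m k by (intro S_antimono) linarith+
      also have "\<dots> \<le> (\<Sum>i\<in>T. n choose i)"
        using T t \<open>m \<ge> 0\<close> m k by (intro hitting_set_weight_ge) auto
      finally show "S n k m \<le> (\<Sum>i\<in>T. n choose i)" .
    qed
    also have "\<dots> = N * M + (N - W 0) + (N - W (n + 1 - k))"
    proof -
      have "(n choose i) * c' i = (n choose i) * c i + (if i = 0 then N - W 0 else 0) +
          (if i = n then N - W (n + 1 - k) else 0)" for i
        by (simp add: c'_def distrib_left)
      then show ?thesis
        by (simp add: sum.distrib total)
    qed
    finally have "d * (N * S n k m) \<le> d * (N * M + (N - W 0) + (N - W (n + 1 - k)))"
      by (rule mult_le_mono2)
    \<comment> \<open>Each deficiency costs at most \<open>N\<close> after multiplication by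
      \<open>d\<close>, and \<open>n > k\<close> gives \<open>d \<ge> 3\<close>.\<close>
    also have "\<dots> \<le> d * (N * M) + 2 * N"
      using ends \<open>d \<ge> 2\<close> by (auto simp: distrib_left diff_mult_distrib2 mult.commute[of N])
    also have "2 * N < d * N"
      using \<open>N > 0\<close> False k by (auto simp: d_def)
    finally have "d * (N * S n k m) < d * (N * (M + 1))"
      by (simp add: distrib_left)
    then have "S n k m < M + 1"
      by (simp only: mult_less_cancel1)
    then show ?thesis
      by (simp add: M_def)
  next
    case True
    \<comment> \<open>Now \<open>d = 2\<close> and the repair may cost a full \<open>N\<close>, too
      much for rounding. The claim becomes that at least two sets are missing.\<close>
    have "m = 0"
      using m True by simp
    have "[int i = 0] (mod int k) \<longleftrightarrow> i = 0 \<or> i = k" if "i \<le> k" for i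
      using that by (auto simp: cong_0_iff dest: dvd_imp_le)
    then have "{i. i \<le> k \<and> [int i = 0] (mod int k)} = {0, k}"
      by auto
    then have "S n k m = 2"
      using True k \<open>m = 0\<close> by (simp add: S_def)
    have d2: "d = 2"
      using True by (simp add: d_def)
    define C where "C = (\<Sum>i\<in>{1..<n}. c i)"
    have W: "W 0 = c 0 + C" "W (n + 1 - k) = C + c n"
      using True k by (simp_all add: W_def C_def sum.atLeast_Suc_lessThan atLeast0LessThan[symmetric])
    have "{..n} = insert 0 (insert n {1..<n})"
      using True k by auto
    then have M: "N * M = c 0 + c n + (\<Sum>i\<in>{1..<n}. (n choose i) * c i)"
      using True k unfolding total[symmetric] by simp
    have "3 * C \<le> (\<Sum>i\<in>{1..<n}. (n choose i) * c i)"
      unfolding C_def sum_distrib_left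
    proof (intro sum_mono mult_le_mono1)
      fix i assume i: "i \<in> {1..<n}"
      then have "n choose 1 \<le> n choose i"
        by (intro binomial_le_between) auto
      then show "3 \<le> n choose i"
        using True k by simp
    qed
    then have le: "c 0 + c n + 3 * C \<le> N * M"
      using M by simp
    have "2 \<le> M"
    proof (cases "C = 0")
      case False
      moreover have "N \<le> 2 * (c 0 + C)" "N \<le> 2 * (C + c n)"
        using ends unfolding d2 W by simp_all
      \<comment> \<open>The sum of the two window bounds gives
        \<open>N \<le> c 0 + c n + 2 * C\<close>, and \<open>le\<close> has a surplus of
        \<open>C > 0\<close>.\<close>
      ultimately have "N < N * M"
        using le by arith
      then have "N * 1 < N * M"
        by simp
      then have "1 < M"
        by (simp only: mult_less_cancel1)
      then show ?thesis
        by simp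
    next
      case True
      then have "c 0 > 0" "c n > 0"
        using ends \<open>N > 0\<close> unfolding d2 W by auto
      \<comment> \<open>Both levels have binomial coefficient 1, so these counts are multiples of
        \<open>N\<close> and, being positive, at least \<open>N\<close>.\<close>
      moreover have "c 0 = N * card {H \<in> Pow {1..n} - \<F>. card H = 0}"
        "c n = N * card {H \<in> Pow {1..n} - \<F>. card H = n}"
        using misses_eq[of 0 n \<F>] misses_eq[of n n \<F>] by (simp_all add: c_def N_def)
      ultimately have "N \<le> c 0" "N \<le> c n"
        by (metis dvd_triv_left dvd_imp_le)+
      then have "N * 2 \<le> N * M"
        using le by arith
      then show ?thesis
        using \<open>N > 0\<close> by simp
    qed
    then show ?thesis
      by (simp add: \<open>S n k m = 2\<close> M_def)
  qed
qed

section \<open>Lower bound: deleting a residue class of levels\<close>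

definition level_family :: "nat \<Rightarrow> nat \<Rightarrow> int \<Rightarrow> nat set set" where
  "level_family n k r = {A \<in> Pow {1..n}. \<not> [int (card A) = r] (mod int k)}"

lemma card_level_family: "card (level_family n k r) + S n k r = 2 ^ n"
proof -
  define R where "R = {i. i \<le> n \<and> [int i = r] (mod int k)}"
  let ?M = "{A \<in> Pow {1..n}. [int (card A) = r] (mod int k)}"
  have "card A \<le> n" if "A \<subseteq> {1..n}" for A
    using card_mono[OF _ that] by simp
  then have "?M = (\<Union>i\<in>R. {A. A \<subseteq> {1..n} \<and> card A = i})"
    by (auto simp: R_def)
  also have "card \<dots> = (\<Sum>i\<in>R. card {A. A \<subseteq> {1..n} \<and> card A = i})"
    by (intro card_UN_disjoint) (auto simp: R_def)
  also have "\<dots> = S n k r"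
    by (simp add: n_subsets S_def R_def)
  finally have "S n k r = card ?M" ..
  moreover have "card (level_family n k r) + card ?M = card (level_family n k r \<union> ?M)"
    by (intro card_Un_disjoint[symmetric]) (auto simp: level_family_def)
  moreover have "level_family n k r \<union> ?M = Pow {1..n}"
    by (auto simp: level_family_def)
  ultimately show ?thesis
    by (simp add: card_Pow)
qed

lemma ex_cong_window:
  assumes "k > 0"
  shows "\<exists>i<k. [int c + int i = r] (mod int k)"
proof (intro exI conjI)
  show "nat ((r - int c) mod int k) < k"
    using assms by (simp add: nat_less_iff)
  show "[int c + int (nat ((r - int c) mod int k)) = r] (mod int k)"
    using assms by (simp add: cong_def mod_simps)
qed

text \<open>Either configuration has a member on each of \<open>k\<close> consecutive levels, one of
  which lies in the deleted class.\<close>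

lemma level_family_free:
  assumes "k \<ge> 2"
  shows "\<not> contains_Y k (level_family n k r)" "\<not> contains_Y' k (level_family n k r)"
proof -
  have avoid: "\<not> [int (card A) = r] (mod int k)" if "A \<in> level_family n k r" for A
    using that by (simp add: level_family_def)
  show "\<not> contains_Y k (level_family n k r)"
  proof
    assume "contains_Y k (level_family n k r)"
    then obtain F1 G where F1: "F1 \<in> level_family n k r"
      and G: "\<forall>i\<in>{1..<k}. G i \<in> level_family n k r"
      and c: "\<forall>i\<in>{1..<k}. card F1 = card (G i) + (k - i)"
      unfolding contains_Y_def by (elim exE conjE)
    obtain i where i: "i < k" "[int (card (G 1)) + int i = r] (mod int k)"
      using ex_cong_window[of k "card (G 1)" r] assms by auto
    show False
    \<comment> \<open>Offset \<open>k - 1\<close> above \<open>G 1\<close> is the level of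
      \<open>F1\<close>; a smaller offset \<open>i\<close> is that of
      \<open>G (i + 1)\<close>.\<close>
    proof (cases "i = k - 1")
      case True
      then have "card F1 = card (G 1) + i"
        using c[rule_format, of 1] assms by simp
      then show ?thesis
        using i(2) avoid[OF F1] by simp
    next
      case False
      then have "i + 1 \<in> {1..<k}" "1 \<in> {1..<k}"
        using i(1) by auto
      then have "card (G (i + 1)) = card (G 1) + i" "G (i + 1) \<in> level_family n k r"
        using c[rule_format, of 1] c[rule_format, of "i + 1"] G by auto
      then show ?thesis
        using i(2) avoid by force
    qed
  qed
  show "\<not> contains_Y' k (level_family n k r)"
  proof
    assume "contains_Y' k (level_family n k r)"
    then obtain F1 G where F1: "F1 \<in> level_family n k r"
      and G: "\<forall>i\<in>{1..<k}. G i \<in> level_family n k r"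
      and c: "\<forall>i\<in>{1..<k}. card (G i) = card F1 + (k - i)"
      unfolding contains_Y'_def by (elim exE conjE)
    obtain i where i: "i < k" "[int (card F1) + int i = r] (mod int k)"
      using ex_cong_window[of k "card F1" r] assms by auto
    show False
    \<comment> \<open>Now \<open>F1\<close> is at the bottom, and offset \<open>i > 0\<close> is the
      level of \<open>G (k - i)\<close>.\<close>
    proof (cases "i = 0")
      case True
      then show ?thesis
        using i avoid[OF F1] by simp
    next
      case False
      then have "k - i \<in> {1..<k}"
        using i(1) by auto
      then have "card (G (k - i)) = card F1 + i" "G (k - i) \<in> level_family n k r"
        using c G i(1) by auto
      then show ?thesis
        using i(2) avoid by force
    qed
  qed
qed

theorem theorem8:
  fixes n k :: nat and m :: int
  assumes "n \<ge> k" and "k \<ge> 3"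
    and "m = \<lceil>(real n - real k) / 2\<rceil>"
  shows "int (La_c n k) = 2 ^ n - int (S n k m)"
proof -
  have "real_of_int m - 1 < (real n - real k) / 2" "(real n - real k) / 2 \<le> real_of_int m"
    using assms(3) ceiling_correct by blast+
  then have "real_of_int (int n - int k) \<le> real_of_int (2 * m)"
    "real_of_int (2 * m) < real_of_int (int n - int k + 2)"
    by (simp_all add: field_simps)
  then have m: "int n - int k \<le> 2 * m" "2 * m \<le> int n - int k + 1"
    unfolding of_int_le_iff of_int_less_iff by simp_all
  define X where "X = {card \<F> | \<F>. \<F> \<subseteq> Pow {1..n} \<and> \<not> contains_Y k \<F> \<and> \<not> contains_Y' k \<F>}"
  have "Max X = card (level_family n k m)"
  proof (rule Max_eqI)
    have "X \<subseteq> card ` Pow (Pow {1..n})"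
      by (auto simp: X_def)
    then show "finite X"
      by (rule finite_subset) simp
    show "card (level_family n k m) \<in> X"
      using level_family_free[of k n m] assms(2) by (auto simp: X_def level_family_def)
  next
    fix x assume "x \<in> X"
    then obtain \<F> where \<F>: "x = card \<F>" "\<F> \<subseteq> Pow {1..n}" "\<not> contains_Y k \<F>" "\<not> contains_Y' k \<F>"
      by (auto simp: X_def)
    have "card \<F> + card (Pow {1..n} - \<F>) = 2 ^ n"
      using \<F>(2) card_mono[OF _ \<F>(2)]
      by (simp add: card_Diff_subset finite_subset card_Pow)
    moreover have "S n k m \<le> card (Pow {1..n} - \<F>)"
      using \<F>(2-) m assms(1,2) by (intro card_Pow_minus_ge)
    ultimately show "x \<le> card (level_family n k m)"
      using card_level_family[of n k m] \<F>(1) by simp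
  qed
  then have "La_c n k + S n k m = 2 ^ n"
    using card_level_family[of n k m] by (simp add: La_c_def X_def)
  then have "int (La_c n k + S n k m) = 2 ^ n"
    by simp
  then show ?thesis
    by simp
qed

end
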